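(* Let $u$ and $v$ be positive real numbers. If $1+\frac{u}{v} > 7.6063$, then the sequence $\left(\frac{1}{n^u\cdot |\sin(n)|^v}\right)_{n\ge 1}$ converges to zero; this includes in particular the pairs $(u,v) = (7,1)$, $(14,2)$, $(20,3)$. Moreover, the series $\sum_{n=1}^{\infty} \frac{1}{n^u\cdot |\sin(n)|^v}$ converges for $(u,v) = (8,1)$, $(15,2)$, $(21,3)$.
   Context: The irrationality measure $\mu(x)$ of a positive real number $x$ is the infimum of those $m$ for which the inequality $0 < \left|x - \frac{p}{q}\right| < \frac{1}{q^m}$ holds only for a finite number of pairs of co-prime positive integers $p$ and $q$. If no such $m$ exists, then $\mu(x) = +\infty$. The statement is a consequence of the known bound of Salikhov (2008), $\mu(\pi)\leq 7.6063\ldots$, which may be taken as given. *)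

theory Defs
  imports Complex_Main "HOL-Library.Extended_Real"
begin

text \<open>The infimum is taken in the extended reals, so that it is \<open>\<infinity>\<close> when no
  exponent \<open>m\<close> qualifies.\<close>

definition irrationality_measure :: "real \<Rightarrow> ereal" where
  "irrationality_measure x =
     Inf (ereal ` {m :: real. finite {(p :: nat, q :: nat).
            0 < p \<and> 0 < q \<and> coprime p q \<and>
            0 < \<bar>x - real p / real q\<bar> \<and>
            \<bar>x - real p / real q\<bar> < 1 / real q powr m}})"

definition flint_hills_term :: "real \<Rightarrow> real \<Rightarrow> nat \<Rightarrow> real" where
  "flint_hills_term u v n = 1 / (real n powr u * \<bar>sin (real n)\<bar> powr v)"

end

theory Submission
  imports Defs "HOL-Analysis.Summation_Tests"
begin

text \<open>If \<open>q\<close> is the integer nearest to \<open>n / pi\<close>, then \<open>\<bar>sin n\<bar>\<close> is comparable to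
  \<open>\<bar>n - q * pi\<bar> = q * \<bar>pi - n / q\<bar>\<close>. An exponent \<open>m\<close> above the irrationality measure of
  \<open>pi\<close> bounds this below by a multiple of \<open>q powr (1 - m)\<close>, hence of \<open>n powr (1 - m)\<close>. So the
  general term is \<open>O (n powr (v * (m - 1) - u))\<close>.\<close>

text \<open>Below \<open>m\<close> lies an exponent \<open>k\<close> with only finitely many
  exceptional coprime pairs. Those pairs are absorbed into the constant \<open>c\<close>; every
  other coprime pair satisfies the bound with exponent \<open>k\<close>, hence with
  \<open>m\<close>.\<close>

lemma irrationality_measure_less_imp_lower_bound:
  assumes "irrationality_measure x < ereal m" "0 < m"
  obtains c where "0 < c"
    "\<And>p q :: nat. 0 < p \<Longrightarrow> 0 < q \<Longrightarrow> x \<noteq> real p / real q \<Longrightarrow>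
       c / real q powr m \<le> \<bar>x - real p / real q\<bar>"
proof -
  define S where "S k = {(p :: nat, q :: nat). 0 < p \<and> 0 < q \<and> coprime p q \<and>
            0 < \<bar>x - real p / real q\<bar> \<and> \<bar>x - real p / real q\<bar> < 1 / real q powr k}" for k
  obtain k where k: "finite (S k)" "k < m"
    using assms(1) unfolding irrationality_measure_def S_def by (auto simp: Inf_less_iff)
  define E where "E = (\<lambda>(p, q). \<bar>x - real p / real q\<bar>) ` S k"
  \<comment> \<open>The 1 keeps the minimum meaningful when \<open>E\<close> is empty and gives
    \<open>c \<le> 1\<close>, which handles the pairs outside \<open>S k\<close>. Positivity holds
    because membership in \<open>S k\<close> demands a nonzero distance.\<close>
  define c where "c = Min (insert 1 E)"
  have finE: "finite E" using k by (simp add: E_def)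
  have "0 < c"
    unfolding c_def using finE by (subst Min_gr_iff) (auto simp: E_def S_def)
  have reduced: "c / real q powr m \<le> \<bar>x - real p / real q\<bar>"
    if pq: "0 < p" "0 < q" "coprime p q" "x \<noteq> real p / real q" for p q :: nat
  proof (cases "(p, q) \<in> S k")
    case True
    have "c \<le> \<bar>x - real p / real q\<bar>"
      unfolding c_def using finE True by (intro Min_le) (force simp: E_def)+
    moreover have "1 \<le> real q powr m"
      using pq assms(2) by (intro ge_one_powr_ge_zero) auto
    ultimately show ?thesis
      using \<open>0 < c\<close> by (smt (verit) divide_le_eq_1 divide_left_mono div_by_1 zero_less_mult_iff)
  next
    case False
    have "c \<le> 1" unfolding c_def using finE by simp
    moreover have "real q powr k \<le> real q powr m"
      using pq k by (intro powr_mono) auto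
    ultimately have "c / real q powr m \<le> 1 / real q powr k"
      using \<open>0 < c\<close> pq by (intro frac_le) auto
    also have "\<dots> \<le> \<bar>x - real p / real q\<bar>"
      using False pq by (auto simp: S_def)
    finally show ?thesis .
  qed
  \<comment> \<open>Passing to lowest terms keeps the fraction and can only shrink the denominator,
    so the bound for the reduced pair is at least as strong.\<close>
  have "c / real q powr m \<le> \<bar>x - real p / real q\<bar>"
    if pq: "0 < p" "0 < q" "x \<noteq> real p / real q" for p q :: nat
  proof -
    obtain p' q' where r: "p = p' * gcd p q" "q = q' * gcd p q" "coprime p' q'"
      using gcd_coprime_exists[of p q] pq by auto
    have pos: "0 < p'" "0 < q'" "0 < gcd p q"
      using r pq by (metis mult_is_0 not_gr_zero)+
    have eq: "real p / real q = real p' / real q'"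
      using pos by (subst r(1), subst r(2)) simp
    have "q' \<le> q"
      using pq r(2) by (metis dvd_imp_le dvd_triv_left)
    then have "c / real q powr m \<le> c / real q' powr m"
      using pos \<open>0 < c\<close> assms(2) by (intro divide_left_mono powr_mono2 mult_pos_pos) auto
    also have "\<dots> \<le> \<bar>x - real p / real q\<bar>"
      using reduced[of p' q'] pos r(3) pq(3) eq by simp
    finally show ?thesis .
  qed
  with \<open>0 < c\<close> show thesis by (rule that)
qed

text \<open>The cubic Taylor remainder is at most \<open>\<bar>y\<bar> ^ 3 / 6\<close>, which on
  this range is at most two thirds of \<open>\<bar>y\<bar>\<close>; one third remains.\<close>

lemma abs_sin_ge_third:
  fixes y :: real
  assumes "\<bar>y\<bar> \<le> 2"
  shows "\<bar>y\<bar> / 3 \<le> \<bar>sin y\<bar>"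
proof -
  have "\<bar>sin y - y\<bar> \<le> \<bar>y\<bar> ^ 3 / 6"
    using Maclaurin_sin_bound[of y 3]
    by (simp add: sin_coeff_def eval_nat_numeral divide_simps)
  moreover have "\<bar>y\<bar> ^ 3 \<le> 4 * \<bar>y\<bar>"
    using mult_mono[of "\<bar>y\<bar>" 2 "\<bar>y\<bar>" 2] assms
      mult_right_mono[of "\<bar>y\<bar> * \<bar>y\<bar>" 4 "\<bar>y\<bar>"] by (simp add: eval_nat_numeral)
  ultimately show ?thesis by linarith
qed

lemma abs_sin_diff_int_pi:
  fixes x :: real
  shows "\<bar>sin (x - of_int k * pi)\<bar> = \<bar>sin x\<bar>"
  by (simp add: sin_diff mult.commute[of _ pi] abs_mult)

lemma abs_sin_nat_lower_bound:
  assumes "irrationality_measure pi < ereal m" "1 < m"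
  obtains C where "0 < C"
    "\<And>n :: nat. 2 \<le> n \<Longrightarrow> sin (real n) \<noteq> 0 \<Longrightarrow> C * real n powr (1 - m) \<le> \<bar>sin (real n)\<bar>"
proof -
  obtain c where c: "0 < c"
    "\<And>p q :: nat. 0 < p \<Longrightarrow> 0 < q \<Longrightarrow> pi \<noteq> real p / real q \<Longrightarrow>
       c / real q powr m \<le> \<bar>pi - real p / real q\<bar>"
    using irrationality_measure_less_imp_lower_bound[OF assms(1)] assms(2) by auto
  have "c / 3 * real n powr (1 - m) \<le> \<bar>sin (real n)\<bar>"
    if n: "2 \<le> n" "sin (real n) \<noteq> 0" for n :: nat
  proof -
    define z where "z = round (real n / pi)"
    \<comment> \<open>The lower bound makes the nearest integer positive; it fails for
      \<open>n = 1\<close>, where \<open>1 / pi\<close> rounds to 0. The upper bound yields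
      \<open>q \<le> n / 2 + 1 / 2 \<le> n\<close>.\<close>
    have quot: "1 / 2 < real n / pi" "real n / pi \<le> real n / 2"
      using n pi_less_4 pi_gt_zero pi_ge_two by (auto simp: field_simps)
    have near: "\<bar>of_int z - real n / pi\<bar> \<le> 1 / 2"
      unfolding z_def by (rule of_int_round_abs_le)
    have "0 < z"
      using near quot by linarith
    then obtain q :: nat where q: "z = int q" "0 < q"
      using zero_less_imp_eq_int by blast
    have "real q \<le> real n"
      using near quot q(1) n(1) by linarith
    have dist: "\<bar>real n - real q * pi\<bar> = pi * \<bar>of_int z - real n / pi\<bar>"
      using pi_gt_zero by (simp add: q abs_mult_pos' algebra_simps abs_minus_commute)
    \<comment> \<open>The crude estimate \<open>pi < 4\<close> already lands in the range of
      \<open>abs_sin_ge_third\<close>.\<close>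
    also have "\<dots> \<le> 4 * (1 / 2)"
      using near pi_less_4 by (intro mult_mono) auto
    finally have small: "\<bar>real n - real q * pi\<bar> \<le> 2" by simp
    have "real n \<noteq> real q * pi"
      using n(2) by auto
    then have "pi \<noteq> real n / real q"
      using q(2) by (auto simp: field_simps)
    then have "c / real q powr m \<le> \<bar>pi - real n / real q\<bar>"
      using c(2)[of n q] n(1) q(2) by simp
    then have "real q * (c / real q powr m) \<le> real q * \<bar>pi - real n / real q\<bar>"
      by (intro mult_left_mono) auto
    also have "\<dots> = \<bar>real n - real q * pi\<bar>"
      using q(2) by (simp add: abs_mult_pos' algebra_simps abs_minus_commute)
    also have "real q * (c / real q powr m) = c * real q powr (1 - m)"
      using q(2) by (simp add: powr_diff)
    finally have "c * real q powr (1 - m) \<le> \<bar>real n - real q * pi\<bar>" .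
    \<comment> \<open>The exponent is negative, so replacing \<open>q\<close> by the larger
      \<open>n\<close> only weakens the lower bound.\<close>
    moreover have "real n powr (1 - m) \<le> real q powr (1 - m)"
      using \<open>real q \<le> real n\<close> q(2) assms(2) by (intro powr_mono2') auto
    ultimately have "c * real n powr (1 - m) \<le> \<bar>real n - real q * pi\<bar>"
      using c(1) by (meson mult_left_mono order.trans less_imp_le)
    also have "\<dots> \<le> 3 * \<bar>sin (real n - real q * pi)\<bar>"
      using abs_sin_ge_third[OF small] by simp
    also have "\<dots> = 3 * \<bar>sin (real n)\<bar>"
      using abs_sin_diff_int_pi[of "real n" z] q(1) by simp
    finally show ?thesis by simp
  qed
  with c(1) show thesis by (intro that[of "c / 3"]) auto
qed

lemma flint_hills_term_upper_bound:
  assumes "irrationality_measure pi < ereal m" "1 < m" "0 < v"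
  obtains K where "0 < K"
    "\<And>n. 2 \<le> n \<Longrightarrow> norm (flint_hills_term u v n) \<le> K * real n powr (v * (m - 1) - u)"
proof -
  obtain C where C: "0 < C"
    "\<And>n :: nat. 2 \<le> n \<Longrightarrow> sin (real n) \<noteq> 0 \<Longrightarrow> C * real n powr (1 - m) \<le> \<bar>sin (real n)\<bar>"
    using abs_sin_nat_lower_bound[OF assms(1,2)] by blast
  have "norm (flint_hills_term u v n) \<le> C powr (- v) * real n powr (v * (m - 1) - u)"
    if n: "2 \<le> n" for n :: nat
  proof (cases "sin (real n) = 0")
    case True
    \<comment> \<open>Here the denominator is 0, and division by zero makes the term 0.\<close>
    then show ?thesis by (simp add: flint_hills_term_def)
  next
    case False
    have "(C * real n powr (1 - m)) powr v \<le> \<bar>sin (real n)\<bar> powr v"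
      using C n False assms(3) by (intro powr_mono2) auto
    then have "real n powr u * (C * real n powr (1 - m)) powr v
        \<le> real n powr u * \<bar>sin (real n)\<bar> powr v"
      by (intro mult_left_mono) auto
    then have "norm (flint_hills_term u v n)
        \<le> 1 / (real n powr u * (C * real n powr (1 - m)) powr v)"
      using C(1) n False by (simp add: flint_hills_term_def frac_le)
    also have "\<dots> = C powr (- v) * real n powr (v * (m - 1) - u)"
    proof -
      have "1 / (real n powr u * (C * real n powr (1 - m)) powr v)
          = C powr (- v) * (real n powr (- u) * real n powr (- ((1 - m) * v)))"
        using C(1) by (simp add: powr_mult powr_powr powr_minus divide_simps)
      also have "real n powr (- u) * real n powr (- ((1 - m) * v)) = real n powr (v * (m - 1) - u)"
        by (simp add: powr_add[symmetric] algebra_simps)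
      finally show ?thesis .
    qed
    finally show ?thesis .
  qed
  with C(1) show thesis by (intro that[of "C powr (- v)"]) auto
qed

lemma flint_hills_term_tendsto_0:
  assumes "irrationality_measure pi < ereal m" "1 < m" "0 < v" "v * (m - 1) < u"
  shows "flint_hills_term u v \<longlonglongrightarrow> 0"
proof -
  obtain K where K: "\<And>n. 2 \<le> n \<Longrightarrow>
      norm (flint_hills_term u v n) \<le> K * real n powr (v * (m - 1) - u)"
    using flint_hills_term_upper_bound[OF assms(1-3)] by metis
  have "(\<lambda>n. real n powr (v * (m - 1) - u)) \<longlonglongrightarrow> 0"
    using assms(4) by (intro tendsto_neg_powr filterlim_real_sequentially) auto
  then have "(\<lambda>n. K * real n powr (v * (m - 1) - u)) \<longlonglongrightarrow> 0"
    by (rule tendsto_mult_right_zero)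
  then show ?thesis
    by (rule Lim_null_comparison[rotated]) (use K in \<open>auto simp: eventually_at_top_linorder\<close>)
qed

text \<open>Comparison with a p-series: the extra 1 in the last assumption puts the exponent
  \<open>v * (m - 1) - u\<close> below -1.\<close>

lemma flint_hills_term_summable:
  assumes "irrationality_measure pi < ereal m" "1 < m" "0 < v" "v * (m - 1) + 1 < u"
  shows "summable (flint_hills_term u v)"
proof -
  obtain K where K: "\<And>n. 2 \<le> n \<Longrightarrow>
      norm (flint_hills_term u v n) \<le> K * real n powr (v * (m - 1) - u)"
    using flint_hills_term_upper_bound[OF assms(1-3)] by metis
  have "summable (\<lambda>n. K * real n powr (v * (m - 1) - u))"
    using assms(4) by (intro summable_mult) (simp add: summable_real_powr_iff)
  then show ?thesis
    by (rule summable_comparison_test_ev[rotated])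
      (use K in \<open>auto simp: eventually_at_top_linorder\<close>)
qed

theorem mainTheorem5:
  assumes salikhov: "irrationality_measure pi \<le> ereal 7.6063"
  shows "(\<forall>u v :: real. 0 < u \<longrightarrow> 0 < v \<longrightarrow> 1 + u / v > 7.6063 \<longrightarrow>
            (\<lambda>n. flint_hills_term u v (Suc n)) \<longlonglongrightarrow> 0) \<and>
         (\<forall>(u, v) \<in> {(7, 1), (14, 2), (20, 3)}.
            (\<lambda>n. flint_hills_term u v (Suc n)) \<longlonglongrightarrow> 0) \<and>
         (\<forall>(u, v) \<in> {(8, 1), (15, 2), (21, 3)}.
            summable (\<lambda>n. flint_hills_term u v (Suc n)))"
proof -
  have lim: "(\<lambda>n. flint_hills_term u v (Suc n)) \<longlonglongrightarrow> 0"
    if uv: "0 < v" "1 + u / v > 7.6063" for u v :: real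
  proof -
    \<comment> \<open>The lemmas want \<open>m\<close> strictly above the measure and
      \<open>v * (m - 1) < u\<close>, that is \<open>m < 1 + u / v\<close>; the strict assumption on
      \<open>u / v\<close> leaves room for both.\<close>
    obtain m where m: "7.6063 < m" "m < 1 + u / v"
      using dense uv(2) by blast
    have "irrationality_measure pi < ereal m"
      using salikhov m(1) by (simp add: le_less_trans)
    moreover have "v * (m - 1) < u"
      using m(2) uv(1) by (simp add: field_simps)
    ultimately have "flint_hills_term u v \<longlonglongrightarrow> 0"
      using m(1) uv(1) by (intro flint_hills_term_tendsto_0[of m]) auto
    then show ?thesis by (rule LIMSEQ_Suc)
  qed
  \<comment> \<open>The value 7.607 is a convenient exponent just above 7.6063. The tightest pair is
    (21, 3), which allows any \<open>m\<close> below 23/3 = 7.666...\<close>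
  have sum: "summable (\<lambda>n. flint_hills_term u v (Suc n))"
    if uv: "0 < v" "v * (7.607 - 1) + 1 < u" for u v :: real
  proof -
    have "irrationality_measure pi < ereal 7.607"
      using salikhov by (rule le_less_trans) simp
    then have "summable (flint_hills_term u v)"
      using uv by (intro flint_hills_term_summable[of "7.607"]) auto
    then show ?thesis by (subst summable_Suc_iff)
  qed
  \<comment> \<open>For the listed limits, \<open>1 + u / v\<close> equals 8, 8 and 23/3, all above
    7.6063.\<close>
  show ?thesis
    using lim sum by auto
qed

end
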